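(* Let $a,\kappa,T_{\rm i}>0$. Let the right state (ahead of the incident shock) have velocity $u_+=0$, temperature $T_+>0$, pressure $p_+>0$ and negligible ionization ($\alpha_+\sim 0$, as made precise in the context), and let the left state (behind the incident shock) be $(\alpha_-,u_-,T_-)$ with $u_->0$. Suppose the two states are joined by an incident shock wave of speed $U_I$. Set $D_+=\dfrac{u_-^2}{a^2\theta_+}$. If $D_+>4$ and $$\frac{\theta_-}{\theta_+}<\left(\sqrt{D_+}-1\right)^2,$$ then the Lax shock conditions for a forward shock wave are satisfied, i.e. $$u_-<U_I<u_-+c_-,\qquad u_++c_+<U_I .$$
   Context: Model: one-dimensional ionized monatomic gas, with degree of ionization $\alpha$, velocity $u$, temperature $T>0$, and constants $a>0$, $\kappa>0$ (Saha constant), $T_{\rm i}>0$ (ionization temperature). Put $\theta=(1+\alpha)T$. For a state with $\alpha\in(0,1)$ and $T>0$, Saha's law gives the pressure $$p=p(\alpha,T)=\frac1\kappa\,\frac{1-\alpha^2}{\alpha^2}\,T^{5/2}e^{-T_{\rm i}/T}.$$ The density is $\rho=p/(a^2\theta)$, the specific volume is $v=1/\rho$, the specific internal energy is $e=\frac32a^2\theta+a^2T_{\rm i}\alpha$, and the specific total energy is $E=\frac{u^2}{2}+e$. The sound speed is $$c=a\sqrt{\frac{5\theta}{3}}\sqrt{\frac{1+\alpha(1-\alpha)\left(\frac54+\frac{T_{\rm i}}{T}+\frac{T_{\rm i}^2}{5T^2}\right)}{1+\alpha(1-\alpha)\left(\frac54+\frac{T_{\rm i}}{T}+\frac{T_{\rm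 i}^2}{3T^2}\right)}} .$$ Approximation $\alpha_+\sim0$ for the right state: since Saha's law does not allow $\alpha_+=0$, the right state is treated as an un-ionized gas with $\alpha_+$ set equal to $0$, where $T_+>0$ and $p_+>0$ are given independently. Thus $\theta_+=T_+$, $\rho_+=p_+/(a^2T_+)$, $e_+=\frac32a^2T_+$, $c_+=a\sqrt{5T_+/3}$. The left state has $\alpha_-\in(0,1)$, $T_->0$ and obeys Saha's law: $p_-=p(\alpha_-,T_-)$. The two states are joined by an incident shock wave of speed $U_I$ if the Rankine-Hugoniot conditions $$U_I(\rho_+-\rho_-)=\rho_+u_+-\rho_-u_-,$$ $$U_I(\rho_+u_+-\rho_-u_-)=\rho_+u_+^2+p_+-\rho_-u_-^2-p_-,$$ $$U_I(\rho_+E_+-\rho_-E_-)=(\rho_+u_+E_++p_+u_+)-(\rho_-u_-E_-+p_-u_-)$$ hold and $\alpha_->\alpha_+$, $T_->T_+$ (the temperature and degree of ionization increase behind the shock). Subscripts $\pm$ denote quantities of the corresponding state. *)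

theory Defs
  imports Complex_Main
begin

text \<open>
  One-dimensional ionized monatomic gas. The pressure is a separate component of a state, because
  Saha's law ties it to ionization and temperature only for genuinely ionized states; for an
  un-ionized state it is an independent datum.
\<close>

record gas_state =
  ionization :: real
  velocity :: real
  temperature :: real
  pressure :: real

definition theta :: "gas_state \<Rightarrow> real" where
  "theta s = (1 + ionization s) * temperature s"

definition density :: "real \<Rightarrow> gas_state \<Rightarrow> real" where
  "density a s = pressure s / (a\<^sup>2 * theta s)"

definition internal_energy :: "real \<Rightarrow> real \<Rightarrow> gas_state \<Rightarrow> real" where
  "internal_energy a Ti s = 3 / 2 * a\<^sup>2 * theta s + a\<^sup>2 * Ti * ionization s"

definition total_energy :: "real \<Rightarrow> real \<Rightarrow> gas_state \<Rightarrow> real" where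
  "total_energy a Ti s = (velocity s)\<^sup>2 / 2 + internal_energy a Ti s"

definition sound_speed :: "real \<Rightarrow> real \<Rightarrow> gas_state \<Rightarrow> real" where
  "sound_speed a Ti s =
    (let \<alpha> = ionization s; T = temperature s in
      a * sqrt (5 * theta s / 3) *
      sqrt ((1 + \<alpha> * (1 - \<alpha>) * (5 / 4 + Ti / T + Ti\<^sup>2 / (5 * T\<^sup>2))) /
            (1 + \<alpha> * (1 - \<alpha>) * (5 / 4 + Ti / T + Ti\<^sup>2 / (3 * T\<^sup>2)))))"

definition saha_pressure :: "real \<Rightarrow> real \<Rightarrow> real \<Rightarrow> real \<Rightarrow> real" where
  "saha_pressure \<kappa> Ti \<alpha> T =
    1 / \<kappa> * ((1 - \<alpha>\<^sup>2) / \<alpha>\<^sup>2) * T powr (5 / 2) * exp (- Ti / T)"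

definition saha_state :: "real \<Rightarrow> real \<Rightarrow> gas_state \<Rightarrow> bool" where
  "saha_state \<kappa> Ti s \<longleftrightarrow>
    0 < ionization s \<and> ionization s < 1 \<and> 0 < temperature s \<and>
    pressure s = saha_pressure \<kappa> Ti (ionization s) (temperature s)"

text \<open>The approximation of negligible ionization, which Saha's law itself excludes.\<close>

definition unionized_state :: "gas_state \<Rightarrow> bool" where
  "unionized_state s \<longleftrightarrow> ionization s = 0 \<and> 0 < temperature s \<and> 0 < pressure s"

text \<open>
  With ionization 0 the general formulas specialize to those of an un-ionized monatomic ideal gas.
\<close>

lemma unionized_state_simps:
  assumes "unionized_state s"
  shows "theta s = temperature s"
    and "density a s = pressure s / (a\<^sup>2 * temperature s)"
    and "internal_energy a Ti s = 3 / 2 * a\<^sup>2 * temperature s"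
    and "sound_speed a Ti s = a * sqrt (5 * temperature s / 3)"
  using assms
  by (simp_all add: unionized_state_def theta_def density_def internal_energy_def sound_speed_def)

text \<open>In the next two definitions \<open>l\<close> and \<open>r\<close> are the left and the right state.\<close>

definition rankine_hugoniot ::
    "real \<Rightarrow> real \<Rightarrow> real \<Rightarrow> gas_state \<Rightarrow> gas_state \<Rightarrow> bool" where
  "rankine_hugoniot a Ti U l r \<longleftrightarrow>
    (let \<rho>l = density a l; \<rho>r = density a r; ul = velocity l; ur = velocity r;
         pl = pressure l; pr = pressure r;
         El = total_energy a Ti l; Er = total_energy a Ti r in
      U * (\<rho>r - \<rho>l) = \<rho>r * ur - \<rho>l * ul \<and>
      U * (\<rho>r * ur - \<rho>l * ul) = \<rho>r * ur\<^sup>2 + pr - \<rho>l * ul\<^sup>2 - pl \<and>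
      U * (\<rho>r * Er - \<rho>l * El) = (\<rho>r * ur * Er + pr * ur) - (\<rho>l * ul * El + pl * ul))"

definition incident_shock ::
    "real \<Rightarrow> real \<Rightarrow> real \<Rightarrow> gas_state \<Rightarrow> gas_state \<Rightarrow> bool" where
  "incident_shock a Ti U l r \<longleftrightarrow>
    rankine_hugoniot a Ti U l r \<and>
    ionization r < ionization l \<and> temperature r < temperature l"

end

theory Submission
  imports Defs
begin

text \<open>
  The energy balance across the shock reads \<open>j (e\<^sub>- - e\<^sub>+ + u\<^sub>-\<^sup>2/2) = p\<^sub>- u\<^sub>-\<close> with mass flux
  \<open>j = \<rho>\<^sub>+ U = \<rho>\<^sub>- (U - u\<^sub>-)\<close>, so \<open>j > 0\<close> and \<open>U > u\<^sub>- > 2 a sqrt \<theta>\<^sub>+ > c\<^sub>+\<close>. The momentum balance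
  \<open>p\<^sub>- - p\<^sub>+ = \<rho>\<^sub>- u\<^sub>- (U - u\<^sub>-)\<close> gives \<open>u\<^sub>- (U - u\<^sub>-) < a\<^sup>2 \<theta>\<^sub>-\<close>. If \<open>U - u\<^sub>- \<ge> c\<^sub>-\<close>, then
  \<open>(U - u\<^sub>-)\<^sup>2 > a\<^sup>2 \<theta>\<^sub>-\<close> because the sound speed exceeds \<open>a sqrt \<theta>\<^sub>-\<close>; hence \<open>U - u\<^sub>- > u\<^sub>-\<close> and
  \<open>\<theta>\<^sub>- / \<theta>\<^sub>+ > D\<^sub>+\<close>, contrary to the hypothesis.
\<close>

lemma saha_state_pressure_pos:
  assumes "\<kappa> > 0" and "saha_state \<kappa> Ti s"
  shows "pressure s > 0"
proof -
  have "0 < ionization s" "ionization s < 1" "0 < temperature s"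
    using assms(2) by (auto simp: saha_state_def)
  moreover from this have "(ionization s)\<^sup>2 < 1"
    by (simp add: power_less_one_iff)
  ultimately show ?thesis
    using assms by (simp add: saha_state_def saha_pressure_def)
qed

text \<open>The squared ratio of the two speeds is \<open>5 / 3 * (N / M)\<close>. The weights 1/5
  and 1/3 make the quadratic terms in \<open>Ti / T\<close> cancel in \<open>5 * N - 3 * M\<close>,
  which leaves 2 plus a nonnegative term.\<close>

lemma isothermal_speed_less_sound_speed:
  assumes "a > 0" and "Ti > 0"
    and "0 \<le> ionization s" and "ionization s \<le> 1" and "temperature s > 0"
  shows "a * sqrt (theta s) < sound_speed a Ti s"
proof -
  define \<alpha> T where "\<alpha> = ionization s" and "T = temperature s"
  define w where "w = \<alpha> * (1 - \<alpha>)"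
  define N where "N = 1 + w * (5 / 4 + Ti / T + Ti\<^sup>2 / (5 * T\<^sup>2))"
  define M where "M = 1 + w * (5 / 4 + Ti / T + Ti\<^sup>2 / (3 * T\<^sup>2))"
  have "w \<ge> 0" and "T > 0"
    using assms by (simp_all add: w_def \<alpha>_def T_def)
  have "M > 0"
    unfolding M_def using \<open>w \<ge> 0\<close> \<open>T > 0\<close> \<open>Ti > 0\<close> by (intro add_pos_nonneg) auto
  have "5 * N - 3 * M = 2 + 2 * w * (5 / 4 + Ti / T)"
    by (simp add: N_def M_def algebra_simps)
  moreover have "0 \<le> 2 * w * (5 / 4 + Ti / T)"
    using \<open>w \<ge> 0\<close> \<open>T > 0\<close> \<open>Ti > 0\<close> by simp
  ultimately have "1 < 5 / 3 * (N / M)"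
    using \<open>M > 0\<close> by (simp add: field_simps)
  moreover have "theta s > 0"
    using assms by (simp add: theta_def)
  ultimately have "theta s < 5 * theta s / 3 * (N / M)"
    using mult_strict_left_mono[of 1 "5 / 3 * (N / M)" "theta s"] by (simp add: mult_ac)
  then have "a * sqrt (theta s) < a * sqrt (5 * theta s / 3 * (N / M))"
    using \<open>a > 0\<close> by simp
  also have "\<dots> = sound_speed a Ti s"
    by (simp only: real_sqrt_mult sound_speed_def Let_def N_def M_def w_def \<alpha>_def T_def mult.assoc)
  finally show ?thesis .
qed

theorem theorem5p1:
  fixes a \<kappa> Ti U D :: real
    and l r :: gas_state
  assumes "a > 0" and "\<kappa> > 0" and "Ti > 0"
    and "unionized_state r" and "velocity r = 0"
    and "saha_state \<kappa> Ti l" and "velocity l > 0"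
    and "incident_shock a Ti U l r"
    and "D = (velocity l)\<^sup>2 / (a\<^sup>2 * theta r)"
    and "D > 4"
    and "theta l / theta r < (sqrt D - 1)\<^sup>2"
  shows "velocity l < U \<and> U < velocity l + sound_speed a Ti l \<and>
         velocity r + sound_speed a Ti r < U"
proof -
  define u where "u = velocity l"
  define \<rho>l \<rho>r where "\<rho>l = density a l" and "\<rho>r = density a r"
  define el er where "el = internal_energy a Ti l" and "er = internal_energy a Ti r"
  define j where "j = \<rho>r * U"
  have "u > 0"
    using assms(7) by (simp add: u_def)
  have l: "0 < ionization l" "ionization l < 1" "0 < temperature l"
    using assms(6) by (auto simp: saha_state_def)
  have r: "ionization r = 0" "0 < temperature r" "0 < pressure r"
    using assms(4) by (auto simp: unionized_state_def)
  have "pressure l > 0"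
    using saha_state_pressure_pos assms(2,6) .
  have \<theta>: "theta l > 0" "theta r > 0"
    using l r by (simp_all add: theta_def)
  have \<rho>: "\<rho>l > 0" "\<rho>r > 0"
    using \<theta> \<open>a > 0\<close> \<open>pressure l > 0\<close> r by (simp_all add: \<rho>l_def \<rho>r_def density_def)
  have shock: "temperature r < temperature l" "rankine_hugoniot a Ti U l r"
    using assms(8) by (simp_all add: incident_shock_def)
  have mass: "j = \<rho>l * (U - u)"
    and momentum: "pressure l - pressure r = \<rho>l * ((U - u) * u)"
    and energy': "U * (\<rho>r * er - \<rho>l * (u\<^sup>2 / 2 + el)) =
      - (\<rho>l * u * (u\<^sup>2 / 2 + el) + pressure l * u)"
    using shock(2) assms(5)
    by (auto simp: rankine_hugoniot_def Let_def total_energy_def j_def u_def \<rho>l_def \<rho>r_def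
        el_def er_def algebra_simps power2_eq_square)
  have energy: "j * (el - er + u\<^sup>2 / 2) = pressure l * u"
  proof -
    \<comment> \<open>The flux is written from the left state next to the left energy and from the
      right state next to \<open>er\<close>, to match \<open>energy'\<close>.\<close>
    have "j * (el - er + u\<^sup>2 / 2) = \<rho>l * (U - u) * (u\<^sup>2 / 2 + el) - \<rho>r * U * er"
      unfolding mass[symmetric] j_def by (simp add: algebra_simps)
    also have "\<dots> = pressure l * u"
      using energy' by (simp add: algebra_simps diff_divide_distrib)
    finally show ?thesis .
  qed
  have "temperature l < theta l"
    using l by (simp add: theta_def)
  moreover have "theta r = temperature r"
    using r by (simp add: theta_def)
  ultimately have "theta r < theta l"
    using shock(1) by linarith
  \<comment> \<open>Both the thermal part and the ionization part of the internal energy rise across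
    the shock.\<close>
  then have "a\<^sup>2 * theta r < a\<^sup>2 * theta l" and "a\<^sup>2 * Ti * ionization l > 0"
    using l \<open>a > 0\<close> \<open>Ti > 0\<close> by simp_all
  then have "er < el"
    unfolding el_def er_def internal_energy_def mult.assoc r(1) mult_zero_right by linarith
  then have "el - er + u\<^sup>2 / 2 > 0"
    by (simp add: add_pos_nonneg)
  \<comment> \<open>No sign of \<open>U\<close> is assumed: the positive work
    \<open>pressure l * u\<close> fixes the direction of the flux.\<close>
  moreover have "j * (el - er + u\<^sup>2 / 2) > 0"
    unfolding energy using \<open>pressure l > 0\<close> \<open>u > 0\<close> by simp
  ultimately have "j > 0"
    by (rule zero_less_mult_pos2[rotated])
  then have "u < U"
    using mass \<rho>(1) by (simp add: zero_less_mult_iff)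
  \<comment> \<open>Comparing with \<open>u\<close> suffices, as the gas ahead is at rest and
    \<open>u < U\<close>; here 5/3 < 4 < \<open>D\<close>.\<close>
  moreover have "sound_speed a Ti r < u"
  proof -
    have "(sound_speed a Ti r)\<^sup>2 = 5 / 3 * (a\<^sup>2 * theta r)"
      using \<theta>(2) unionized_state_simps[OF assms(4)] by (simp add: power_mult_distrib)
    also have "\<dots> < 4 * (a\<^sup>2 * theta r)"
      using \<theta> \<open>a > 0\<close> by simp
    also have "\<dots> < D * (a\<^sup>2 * theta r)"
      using \<open>D > 4\<close> \<theta> \<open>a > 0\<close> by (intro mult_strict_right_mono) auto
    also have "\<dots> = u\<^sup>2"
      using \<theta> \<open>a > 0\<close> by (simp add: assms(9) u_def)
    finally show ?thesis
      using \<open>u > 0\<close> by (simp add: power2_less_imp_less)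
  qed
  moreover have "U - u < sound_speed a Ti l"
  proof (rule ccontr)
    assume "\<not> U - u < sound_speed a Ti l"
    then have "a * sqrt (theta l) < U - u"
      using isothermal_speed_less_sound_speed[of a Ti l] assms(1,3) l by linarith
    then have "(a * sqrt (theta l))\<^sup>2 < (U - u)\<^sup>2"
      using \<open>a > 0\<close> \<theta> by (intro power_strict_mono) auto
    then have sq: "a\<^sup>2 * theta l < (U - u) * (U - u)"
      using \<theta> by (simp add: power_mult_distrib power2_eq_square[of "U - u"])
    \<comment> \<open>Dropping \<open>pressure r > 0\<close> and inserting the gas law lets the
      density cancel.\<close>
    have "\<rho>l * ((U - u) * u) < pressure l"
      using momentum r by simp
    also have "pressure l = \<rho>l * (a\<^sup>2 * theta l)"
      using \<theta> \<open>a > 0\<close> by (simp add: \<rho>l_def density_def)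
    finally have flux: "(U - u) * u < a\<^sup>2 * theta l"
      using \<rho> by simp
    with sq have "(U - u) * u < (U - u) * (U - u)"
      by linarith
    then have "u < U - u"
      using \<open>u < U\<close> by simp
    then have "u\<^sup>2 < (U - u) * u"
      using \<open>u > 0\<close> by (simp add: power2_eq_square)
    with flux have "u\<^sup>2 < a\<^sup>2 * theta l"
      by linarith
    then have "D < theta l / theta r"
      using \<theta> \<open>a > 0\<close> by (simp add: assms(9) u_def field_simps)
    \<comment> \<open>As 0 < \<open>sqrt D - 1\<close> < \<open>sqrt D\<close>, the assumed bound on
      the ratio lies below \<open>D\<close>.\<close>
    moreover have "(sqrt D - 1)\<^sup>2 < (sqrt D)\<^sup>2"
      using \<open>D > 4\<close> by (intro power_strict_mono) auto
    ultimately show False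
      using assms(10,11) by simp
  qed
  ultimately show ?thesis
    using assms(5) by (simp add: u_def)
qed

end
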